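(* Let $b>1$ and $n\ge 0$ be integers, and let $\{P_x\}_{0\le x<2^b}$ be a family of polynomials in $\mathbb{C}[z]$. Let $\tilde w=\tilde w(z)=\operatorname{diag}(1,z)\otimes \mathbb{1}_{2^{b-1}}=\operatorname{diag}(1,\dots,1,z,\dots,z)$, a $2^b\times 2^b$ diagonal matrix with $2^{b-1}$ entries equal to $1$ followed by $2^{b-1}$ entries equal to $z$. There exist $A_0,\dots,A_n\in SU(2^b)$ (independent of $z$) such that $$A_n\,\tilde w\,A_{n-1}\,\tilde w\cdots\tilde w\,A_0\,|0\rangle=\sum_{x=0}^{2^b-1}P_x(z)\,|x\rangle\qquad\text{for all } z\in U(1)$$ (with exactly $n$ occurrences of $\tilde w$) if and only if both of the following hold: (i) $\deg P_x\le n$ for every $0\le x<2^b$; (ii) $\sum_{x=0}^{2^b-1}|P_x(z)|^2=1$ for every $z\in U(1)$.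
   Context: $U(1)=\{z\in\mathbb{C}:|z|=1\}$. $|0\rangle,\dots,|2^b-1\rangle$ denotes the standard orthonormal basis of $\mathbb{C}^{2^b}$. $\mathbb{1}_m$ is the $m\times m$ identity matrix. *)

theory Defs
  imports
    "Jordan_Normal_Form.Determinant"
    "Jordan_Normal_Form.Schur_Decomposition"
begin

definition SU :: "nat \<Rightarrow> complex mat set" where
  "SU N = {A \<in> carrier_mat N N.
     mat_adjoint A * A = 1\<^sub>m N \<and> A * mat_adjoint A = 1\<^sub>m N \<and> det A = 1}"

(* diag(1, z) tensored with the identity of size 2^(b-1): the tensor factor diag(1, z) acts on
   the most significant bit of the index i, so the first half of the diagonal is 1. *)
definition w_tilde :: "nat \<Rightarrow> complex \<Rightarrow> complex mat" where
  "w_tilde b z = mat_diag (2 ^ b) (\<lambda>i. if i < 2 ^ (b - 1) then 1 else z)"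

(* A n * w * A (n - 1) * w * ... * w * A 0, with n occurrences of w = w_tilde b z *)
primrec qsp_product :: "nat \<Rightarrow> (nat \<Rightarrow> complex mat) \<Rightarrow> complex \<Rightarrow> nat \<Rightarrow> complex mat" where
  "qsp_product b A z 0 = A 0"
| "qsp_product b A z (Suc k) = A (Suc k) * w_tilde b z * qsp_product b A z k"

end

theory Submission
  imports Defs
begin

text \<open>For sufficiency, induct on \<open>n\<close> and write \<open>P = (P\<^sub>x)\<^sub>x\<close> as a polynomial with vector coefficients
  \<open>c\<^sub>0, \<dots>, c\<^sub>n\<close>. Comparing coefficients in the normalisation on the unit circle shows that \<open>c\<^sub>0\<close>
  and \<open>c\<^sub>n\<close> are orthogonal when \<open>n > 0\<close>. Hence some \<open>H\<close> in the special unitary group, a product of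
  two Householder reflections corrected by a diagonal phase, sends \<open>c\<^sub>0\<close> to the line of the first
  basis vector and \<open>c\<^sub>n\<close> to the line of a basis vector in the second half. Then the second half of
  \<open>H P\<close> is divisible by \<open>z\<close> and its first half has degree below \<open>n\<close>, so \<open>H P = w Q\<close> with \<open>Q\<close> of
  degree below \<open>n\<close> and again of norm one on the circle.\<close>

section \<open>Adjoint matrices and the complex scalar product\<close>

lemma index_mat_adjoint [simp]:
  assumes "i < dim_col A" "j < dim_row A"
  shows "mat_adjoint A $$ (i, j) = conjugate (A $$ (j, i))"
  using assms by (simp add: mat_adjoint_def mat_of_rows_index)

lemma dim_mat_adjoint [simp]:
  "dim_row (mat_adjoint A) = dim_col A" "dim_col (mat_adjoint A) = dim_row A"
  by (simp_all add: mat_adjoint_def)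

lemma mat_adjoint_carrier [simp, intro]:
  "A \<in> carrier_mat n m \<Longrightarrow> mat_adjoint A \<in> carrier_mat m n"
  by (intro carrier_matI) auto

lemma mat_adjoint_adjoint [simp]: "mat_adjoint (mat_adjoint A) = A"
  by (rule eq_matI) auto

lemma mat_adjoint_mult:
  fixes A B :: "complex mat"
  assumes "A \<in> carrier_mat n m" "B \<in> carrier_mat m k"
  shows "mat_adjoint (A * B) = mat_adjoint B * mat_adjoint A"
  using assms by (intro eq_matI) (auto simp: scalar_prod_def mult.commute)

lemma det_mat_adjoint:
  fixes A :: "complex mat"
  assumes "A \<in> carrier_mat n n"
  shows "det (mat_adjoint A) = cnj (det A)"
proof -
  interpret cnj: comm_ring_hom cnj by unfold_locales auto
  have "mat_adjoint A = transpose_mat (map_mat cnj A)"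
    using assms by (intro eq_matI) auto
  then show ?thesis
    using assms det_transpose[of "map_mat cnj A" n] by simp
qed

lemma scalar_prod_mat_adjoint:
  fixes A :: "complex mat"
  assumes "A \<in> carrier_mat n m" "x \<in> carrier_vec m" "y \<in> carrier_vec n"
  shows "(A *\<^sub>v x) \<bullet>c y = x \<bullet>c (mat_adjoint A *\<^sub>v y)"
proof -
  have "(A *\<^sub>v x) \<bullet>c y = (\<Sum>i<n. \<Sum>j<m. A $$ (i,j) * x $ j * cnj (y $ i))"
    using assms by (simp add: scalar_prod_def sum_distrib_right lessThan_atLeast0)
  also have "\<dots> = (\<Sum>j<m. \<Sum>i<n. A $$ (i,j) * x $ j * cnj (y $ i))"
    by (rule sum.swap)
  also have "\<dots> = x \<bullet>c (mat_adjoint A *\<^sub>v y)"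
    using assms by (simp add: scalar_prod_def sum_distrib_left lessThan_atLeast0 mult_ac)
  finally show ?thesis .
qed

lemma scalar_prod_self_complex:
  fixes v :: "complex vec"
  shows "v \<bullet>c v = complex_of_real (\<Sum>i<dim_vec v. (cmod (v $ i))\<^sup>2)"
  by (simp add: scalar_prod_def lessThan_atLeast0 complex_norm_square flip: of_real_power)

lemma mat_mult_unit_vec:
  fixes A :: "'a :: semiring_1 mat"
  assumes "A \<in> carrier_mat m n" "j < n"
  shows "A *\<^sub>v unit_vec n j = col A j"
  using assms by (intro eq_vecI) auto

section \<open>Unitary and special unitary matrices\<close>

text \<open>The unitary group before the determinant is normalised: the reflections and
  \<open>w_tilde b z\<close> on the unit circle live here, although their determinants can differ
  from 1.\<close>

definition unitary_mats :: "nat \<Rightarrow> complex mat set" where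
  "unitary_mats N = {A \<in> carrier_mat N N. mat_adjoint A * A = 1\<^sub>m N}"

lemma unitary_mats_carrier: "A \<in> unitary_mats N \<Longrightarrow> A \<in> carrier_mat N N"
  by (simp add: unitary_mats_def)

lemma unitary_mats_right_inverse:
  assumes "A \<in> unitary_mats N"
  shows "A * mat_adjoint A = 1\<^sub>m N"
  using assms mat_mult_left_right_inverse[of "mat_adjoint A" N A]
  by (auto simp: unitary_mats_def)

lemma unitary_mats_adjoint: "A \<in> unitary_mats N \<Longrightarrow> mat_adjoint A \<in> unitary_mats N"
  using unitary_mats_right_inverse by (auto simp: unitary_mats_def)

lemma unitary_mats_mult:
  assumes "A \<in> unitary_mats N" "B \<in> unitary_mats N"
  shows "A * B \<in> unitary_mats N"
proof -
  have A: "A \<in> carrier_mat N N" "mat_adjoint A * A = 1\<^sub>m N"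
    and B: "B \<in> carrier_mat N N" "mat_adjoint B * B = 1\<^sub>m N"
    using assms by (auto simp: unitary_mats_def)
  have "mat_adjoint (A * B) * (A * B) = mat_adjoint B * (mat_adjoint A * (A * B))"
    using A(1) B(1)
    by (simp add: mat_adjoint_mult[of A N N B N]
        assoc_mult_mat[OF mat_adjoint_carrier mat_adjoint_carrier, of B N N A N "A * B" N])
  also have "mat_adjoint A * (A * B) = B"
    using A B(1) assoc_mult_mat[of "mat_adjoint A" N N A N B N] by auto
  finally show ?thesis
    using A B by (auto simp: unitary_mats_def)
qed

lemma SU_eq: "SU N = {A \<in> unitary_mats N. det A = 1}"
  using unitary_mats_right_inverse by (auto simp: SU_def unitary_mats_def)

lemma SU_mult:
  assumes "A \<in> SU N" "B \<in> SU N"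
  shows "A * B \<in> SU N"
  using assms det_mult[OF unitary_mats_carrier unitary_mats_carrier, of A N B]
  by (auto simp: SU_eq unitary_mats_mult)

lemma SU_adjoint: "A \<in> SU N \<Longrightarrow> mat_adjoint A \<in> SU N"
  using det_mat_adjoint[OF unitary_mats_carrier, of A N]
  by (auto simp: SU_eq unitary_mats_adjoint)

lemma unitary_adjoint_mult_vec:
  assumes "A \<in> unitary_mats N" "x \<in> carrier_vec N"
  shows "mat_adjoint A *\<^sub>v (A *\<^sub>v x) = x"
proof -
  have A: "A \<in> carrier_mat N N" "mat_adjoint A * A = 1\<^sub>m N"
    using assms by (auto simp: unitary_mats_def)
  have "mat_adjoint A *\<^sub>v (A *\<^sub>v x) = (mat_adjoint A * A) *\<^sub>v x"
    using A(1) assms(2) by (intro assoc_mult_mat_vec[symmetric]) auto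
  then show ?thesis
    using A(2) assms(2) by simp
qed

lemma unitary_scalar_prod:
  assumes "A \<in> unitary_mats N" "x \<in> carrier_vec N" "y \<in> carrier_vec N"
  shows "(A *\<^sub>v x) \<bullet>c (A *\<^sub>v y) = x \<bullet>c y"
proof -
  have "A \<in> carrier_mat N N"
    using assms by (simp add: unitary_mats_def)
  then show ?thesis
    using assms scalar_prod_mat_adjoint[of A N N x "A *\<^sub>v y"]
    by (simp add: unitary_adjoint_mult_vec)
qed

text \<open>In this product form the conjugate of the determinant is visibly the phase that corrects
  the determinant to 1.\<close>

lemma det_unitary_mult_cnj:
  assumes "A \<in> unitary_mats N"
  shows "det A * cnj (det A) = 1"
proof -
  have A: "A \<in> carrier_mat N N" "mat_adjoint A * A = 1\<^sub>m N"
    using assms by (auto simp: unitary_mats_def)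
  have "det (mat_adjoint A) * det A = 1"
    using A det_mult[of "mat_adjoint A" N A] by auto
  then show ?thesis
    using A by (simp add: det_mat_adjoint mult.commute)
qed

section \<open>Diagonal matrices\<close>

lemma mat_diag_mult_vec:
  fixes f :: "nat \<Rightarrow> 'a :: comm_ring_1"
  assumes "x \<in> carrier_vec N"
  shows "mat_diag N f *\<^sub>v x = vec N (\<lambda>i. f i * x $ i)"
proof (rule eq_vecI)
  fix i assume "i < dim_vec (vec N (\<lambda>i. f i * x $ i))"
  then have i: "i < N" by simp
  then have "(mat_diag N f *\<^sub>v x) $ i = (\<Sum>j\<in>{0..<N}. (if i = j then f j else 0) * x $ j)"
    using assms by (simp add: mat_diag_def scalar_prod_def)
  also have "\<dots> = (\<Sum>j\<in>{0..<N}. if i = j then f j * x $ j else 0)"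
    by (rule sum.cong) auto
  also have "\<dots> = f i * x $ i"
    using i by simp
  finally show "(mat_diag N f *\<^sub>v x) $ i = vec N (\<lambda>i. f i * x $ i) $ i"
    using i by simp
qed (simp add: mat_diag_def)

lemma mat_diag_mult_unit_vec:
  fixes f :: "nat \<Rightarrow> 'a :: comm_ring_1"
  assumes "j < N"
  shows "mat_diag N f *\<^sub>v unit_vec N j = f j \<cdot>\<^sub>v unit_vec N j"
  using assms by (auto simp: mat_diag_mult_vec unit_vec_def)

lemma mat_diag_unitary:
  assumes "\<And>i. i < N \<Longrightarrow> cmod (f i) = 1"
  shows "mat_diag N f \<in> unitary_mats N"
proof -
  have "mat_adjoint (mat_diag N f) = mat_diag N (\<lambda>i. cnj (f i))"
    by (rule eq_matI) (auto simp: mat_diag_def)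
  moreover have "mat_diag N (\<lambda>i. cnj (f i) * f i) = 1\<^sub>m N"
    using assms
    by (intro eq_matI) (auto simp: mat_diag_def mult.commute[of "cnj _"] simp flip: complex_norm_square)
  ultimately show ?thesis
    by (simp add: unitary_mats_def)
qed

lemma det_mat_diag: "det (mat_diag N f) = (\<Prod>i<N. f i)"
proof -
  have "det (mat_diag N f) = prod_list (diag_mat (mat_diag N f))"
    by (rule det_upper_triangular[of _ N]) (auto simp: mat_diag_def)
  also have "diag_mat (mat_diag N f) = map f [0..<N]"
    by (auto simp: diag_mat_def mat_diag_def)
  finally show ?thesis
    by (simp add: prod.list_conv_set_nth lessThan_atLeast0)
qed

section \<open>Householder reflections and moving vectors onto axes\<close>

text \<open>For \<open>w = 0\<close> the division by zero makes this the identity matrix.\<close>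
definition reflection :: "nat \<Rightarrow> complex vec \<Rightarrow> complex mat" where
  "reflection N w = mat N N (\<lambda>(i, j). (if i = j then 1 else 0) - 2 / (w \<bullet>c w) * (w $ i * cnj (w $ j)))"

lemma reflection_carrier: "reflection N w \<in> carrier_mat N N"
  by (simp add: reflection_def)

lemma reflection_mult_vec:
  assumes "w \<in> carrier_vec N" "x \<in> carrier_vec N"
  shows "reflection N w *\<^sub>v x = x - (2 * (x \<bullet>c w) / (w \<bullet>c w)) \<cdot>\<^sub>v w"
proof (rule eq_vecI)
  fix i assume "i < dim_vec (x - (2 * (x \<bullet>c w) / (w \<bullet>c w)) \<cdot>\<^sub>v w)"
  then have i: "i < N" using assms by simp
  have "(reflection N w *\<^sub>v x) $ i =
      (\<Sum>j\<in>{0..<N}. (if i = j then x $ j else 0) - 2 / (w \<bullet>c w) * w $ i * (x $ j * cnj (w $ j)))"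
    using i assms by (auto simp: reflection_def scalar_prod_def algebra_simps intro!: sum.cong)
  also have "\<dots> = x $ i - 2 / (w \<bullet>c w) * w $ i * (x \<bullet>c w)"
    using i assms by (subst sum_subtractf, subst sum_distrib_left[symmetric]) (simp add: scalar_prod_def)
  finally show "(reflection N w *\<^sub>v x) $ i = (x - (2 * (x \<bullet>c w) / (w \<bullet>c w)) \<cdot>\<^sub>v w) $ i"
    using i assms by simp
qed (use assms in \<open>simp add: reflection_def\<close>)

text \<open>A reflection is self-adjoint and involutive, hence inverse to its own adjoint. The
  involution is checked on vectors and then read off column by column.\<close>

lemma reflection_unitary:
  assumes w: "w \<in> carrier_vec N"
  shows "reflection N w \<in> unitary_mats N"
proof -
  let ?R = "reflection N w"
  have R: "?R \<in> carrier_mat N N" by (rule reflection_carrier)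
  have real: "cnj (w \<bullet>c w) = w \<bullet>c w"
    by (simp add: scalar_prod_self_complex)
  have adj: "mat_adjoint ?R = ?R"
    by (rule eq_matI) (auto simp: reflection_def real)
  have invol: "?R *\<^sub>v (?R *\<^sub>v x) = x" if x: "x \<in> carrier_vec N" for x
  proof (cases "w \<bullet>c w = 0")
    case True
    then show ?thesis
      using w x by (auto simp: reflection_mult_vec intro!: eq_vecI)
  next
    case False
    define c where "c = 2 * (x \<bullet>c w) / (w \<bullet>c w)"
    have Rx: "?R *\<^sub>v x = x - c \<cdot>\<^sub>v w"
      using w x by (simp add: reflection_mult_vec c_def)
    \<comment> \<open>The first application negates the component along \<open>w\<close>, so the
      second one subtracts \<open>- c\<close> times \<open>w\<close> and restores
      \<open>x\<close>.\<close>
    have "(x - c \<cdot>\<^sub>v w) \<bullet>c w = x \<bullet>c w - c * (w \<bullet>c w)"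
      using w x by (simp add: minus_scalar_prod_distrib[of _ N])
    also have "\<dots> = - (x \<bullet>c w)"
      using False by (simp add: c_def)
    finally have "?R *\<^sub>v (x - c \<cdot>\<^sub>v w) = (x - c \<cdot>\<^sub>v w) - (- c) \<cdot>\<^sub>v w"
      using w x by (simp add: reflection_mult_vec c_def)
    then show ?thesis
      using w x unfolding Rx by (auto intro!: eq_vecI)
  qed
  have "?R * ?R = 1\<^sub>m N"
  proof (rule eq_matI)
    fix i j assume "i < dim_row (1\<^sub>m N)" "j < dim_col (1\<^sub>m N)"
    then have ij: "i < N" "j < N" by auto
    have "(?R * ?R) $$ (i, j) = col (?R * ?R) j $ i"
      using ij R by simp
    also have "col (?R * ?R) j = (?R * ?R) *\<^sub>v unit_vec N j"
      using ij R by (intro mat_mult_unit_vec[symmetric]) auto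
    also have "\<dots> = unit_vec N j"
      using R invol[of "unit_vec N j"] by (simp add: assoc_mult_mat_vec[of _ N N _ N])
    finally show "(?R * ?R) $$ (i, j) = 1\<^sub>m N $$ (i, j)"
      using ij by (simp add: unit_vec_def)
  qed (use R in auto)
  then show ?thesis
    using adj R by (simp add: unitary_mats_def)
qed

text \<open>The last clause lets a second reflection move another vector without disturbing one that
  already lies on a different axis.\<close>

lemma reflection_onto_axis:
  fixes v :: "complex vec"
  assumes v: "v \<in> carrier_vec N" and j: "j < N"
  obtains H c where "H \<in> unitary_mats N" "H *\<^sub>v v = c \<cdot>\<^sub>v unit_vec N j"
    "\<And>x. x \<in> carrier_vec N \<Longrightarrow> x \<bullet>c v = 0 \<Longrightarrow> x $ j = 0 \<Longrightarrow> H *\<^sub>v x = x"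
proof -
  define S where "S = (\<Sum>i<N. (cmod (v $ i))\<^sup>2)"
  have S: "v \<bullet>c v = complex_of_real S" "S \<ge> 0"
    using v by (auto simp: scalar_prod_self_complex S_def intro: sum_nonneg)
  \<comment> \<open>The phase of \<open>c\<close> makes the scalar product of \<open>v\<close> with \<open>c e\<^sub>j\<close> real; only then does
     the reflection along \<open>v - c e\<^sub>j\<close> carry \<open>v\<close> to \<open>c e\<^sub>j\<close> over the complex numbers.\<close>
  define c where "c = complex_of_real (sqrt S) * (if v $ j = 0 then 1 else sgn (v $ j))"
  have cc: "c * cnj c = complex_of_real S"
    using S(2) by (simp add: c_def sgn_eq complex_norm_square[symmetric] norm_mult norm_divide
        power_mult_distrib del: complex_cnj_mult)
  have real: "cnj c * v $ j = c * cnj (v $ j)"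
    by (simp add: c_def sgn_eq)
  let ?e = "unit_vec N j :: complex vec"
  define w where "w = v - c \<cdot>\<^sub>v ?e"
  have w: "w \<in> carrier_vec N"
    using v by (simp add: w_def)
  have sp: "x \<bullet>c w = x \<bullet>c v - cnj c * x $ j" if x: "x \<in> carrier_vec N" for x
  proof -
    have "x \<bullet>c w = (\<Sum>i\<in>{0..<N}. x $ i * cnj (v $ i) - (if i = j then x $ i * cnj c else 0))"
      using x v j by (auto simp: w_def scalar_prod_def algebra_simps unit_vec_def intro!: sum.cong)
    also have "\<dots> = x \<bullet>c v - cnj c * x $ j"
      using x v j by (simp add: sum_subtractf) (simp add: scalar_prod_def)
    finally show ?thesis .
  qed
  have "?e \<bullet>c v = cnj (v $ j)"
    using v j by simp
  \<comment> \<open>Since \<open>v\<close> and \<open>c\<close> times \<open>?e\<close> have equal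
    norm and a real scalar product, the coefficient of \<open>w\<close> in the reflection of
    \<open>v\<close> is exactly 1, and \<open>v - w\<close> is the target.\<close>
  then have ww: "w \<bullet>c w = 2 * (v \<bullet>c w)"
    using v j w S cc real sp[of v] sp[of ?e]
    by (simp add: w_def[of] minus_scalar_prod_distrib[of _ N] algebra_simps)
  have "reflection N w *\<^sub>v v = c \<cdot>\<^sub>v ?e"
  proof (cases "w \<bullet>c w = 0")
    case True
    then have "w = 0\<^sub>v N"
      using w by (simp add: conjugate_square_eq_0_vec)
    then have "v = c \<cdot>\<^sub>v ?e"
      using v by (auto simp: w_def vec_eq_iff)
    then show ?thesis
      using True v w by (auto simp: reflection_mult_vec intro!: eq_vecI)
  next
    case False
    then have "reflection N w *\<^sub>v v = v - 1 \<cdot>\<^sub>v w"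
      using v w ww by (simp add: reflection_mult_vec)
    then show ?thesis
      using v by (auto simp: w_def)
  qed
  \<comment> \<open>Such an \<open>x\<close> is orthogonal to both \<open>v\<close> and the axis,
    hence to \<open>w\<close>.\<close>
  moreover have "reflection N w *\<^sub>v x = x"
    if "x \<in> carrier_vec N" "x \<bullet>c v = 0" "x $ j = 0" for x
    using that w sp[of x] by (auto simp: reflection_mult_vec)
  ultimately show thesis
    using that reflection_unitary[OF w] by blast
qed

text \<open>The first reflection \<open>H\<close> puts \<open>u\<close> on axis \<open>j\<close> and
  keeps the images of \<open>u\<close> and \<open>v\<close> orthogonal. The image of
  \<open>u\<close> is therefore fixed by the second reflection \<open>G\<close>, which puts the
  image of \<open>v\<close> on axis \<open>k\<close>. A diagonal factor repairs the determinant
  while preserving every axis.\<close>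

lemma SU_onto_axes:
  fixes u v :: "complex vec"
  assumes u: "u \<in> carrier_vec N" and v: "v \<in> carrier_vec N" and orth: "u \<bullet>c v = 0"
    and jk: "j < N" "k < N" "j \<noteq> k"
  obtains H c d where "H \<in> SU N" "H *\<^sub>v u = c \<cdot>\<^sub>v unit_vec N j" "H *\<^sub>v v = d \<cdot>\<^sub>v unit_vec N k"
proof -
  obtain H c where H: "H \<in> unitary_mats N" "H *\<^sub>v u = c \<cdot>\<^sub>v unit_vec N j"
    using reflection_onto_axis[OF u jk(1)] by metis
  have Hc: "H \<in> carrier_mat N N"
    by (rule unitary_mats_carrier) fact
  have Hv: "H *\<^sub>v v \<in> carrier_vec N"
    using Hc v by simp
  obtain G d where G: "G \<in> unitary_mats N" "G *\<^sub>v (H *\<^sub>v v) = d \<cdot>\<^sub>v unit_vec N k"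
    and G_fix: "\<And>x. x \<in> carrier_vec N \<Longrightarrow> x \<bullet>c (H *\<^sub>v v) = 0 \<Longrightarrow> x $ k = 0 \<Longrightarrow> G *\<^sub>v x = x"
    using reflection_onto_axis[OF Hv jk(2)] by metis
  have Gc: "G \<in> carrier_mat N N"
    by (rule unitary_mats_carrier) fact
  have GHu: "G *\<^sub>v (H *\<^sub>v u) = c \<cdot>\<^sub>v unit_vec N j"
  proof -
    have "G *\<^sub>v (H *\<^sub>v u) = H *\<^sub>v u"
    proof (rule G_fix)
      show "(H *\<^sub>v u) \<bullet>c (H *\<^sub>v v) = 0"
        using unitary_scalar_prod[OF H(1) u v] orth by simp
      show "(H *\<^sub>v u) $ k = 0"
        using jk by (simp add: H(2))
    qed (use Hc u in simp)
    then show ?thesis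
      by (simp add: H(2))
  qed
  have GH: "G * H \<in> unitary_mats N"
    by (rule unitary_mats_mult) fact+
  \<comment> \<open>The whole determinant correction sits in entry \<open>j\<close>, where it merely
    changes the scalar \<open>c\<close>.\<close>
  define f where "f = (\<lambda>i::nat. if i = j then cnj (det (G * H)) else 1)"
  have det: "det (G * H) * cnj (det (G * H)) = 1"
    by (rule det_unitary_mult_cnj) fact
  then have "cmod (det (G * H)) = 1"
    by (metis complex_norm_square norm_ge_zero of_real_eq_1_iff power2_eq_1_iff
        abs_of_nonneg abs_minus_cancel abs_one)
  then have D: "mat_diag N f \<in> unitary_mats N"
    by (intro mat_diag_unitary) (auto simp: f_def)
  have "det (mat_diag N f) = cnj (det (G * H))"
    using jk by (simp add: det_mat_diag f_def)
  then have "det (mat_diag N f * (G * H)) = 1"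
    using Gc Hc det det_mult[of "mat_diag N f" N "G * H"] by (simp add: mult.commute)
  then have "mat_diag N f * (G * H) \<in> SU N"
    using unitary_mats_mult[OF D GH] by (simp add: SU_eq)
  moreover have DGH: "mat_diag N f * (G * H) *\<^sub>v x = mat_diag N f *\<^sub>v (G *\<^sub>v (H *\<^sub>v x))"
    if "x \<in> carrier_vec N" for x
    using Gc Hc that by (simp add: assoc_mult_mat_vec[of _ N N _ N])
  have "mat_diag N f * (G * H) *\<^sub>v u = (f j * c) \<cdot>\<^sub>v unit_vec N j"
    using u jk by (subst DGH) (auto simp: GHu mat_diag_mult_vec unit_vec_def)
  moreover have "mat_diag N f * (G * H) *\<^sub>v v = (f k * d) \<cdot>\<^sub>v unit_vec N k"
    using v jk by (subst DGH) (auto simp: G(2) mat_diag_mult_vec unit_vec_def)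
  ultimately show thesis
    using that by blast
qed

text \<open>If \<open>H\<close> sends \<open>v\<close> to \<open>c\<close> times the first basis
  vector, then its adjoint sends that multiple back to \<open>v\<close>; a diagonal matrix of
  determinant 1 supplies the phase \<open>c\<close>.\<close>

lemma SU_first_column:
  fixes v :: "complex vec"
  assumes v: "v \<in> carrier_vec N" and norm: "v \<bullet>c v = 1" and N: "N \<ge> 2"
  obtains A where "A \<in> SU N" "A *\<^sub>v unit_vec N 0 = v"
proof -
  \<comment> \<open>The zero vector takes the second slot, so the orthogonality condition is
    trivial.\<close>
  obtain H c where H: "H \<in> SU N" "H *\<^sub>v v = c \<cdot>\<^sub>v unit_vec N 0"
    using SU_onto_axes[of v N "0\<^sub>v N" 0 1] v N by (metis One_nat_def Suc_1 Suc_le_lessD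
        conjugate_zero_vec less_le_trans pos2 scalar_prod_right_zero zero_carrier_vec zero_neq_one)
  have HU: "H \<in> unitary_mats N"
    using H by (simp add: SU_eq)
  have "c * cnj c = (H *\<^sub>v v) \<bullet>c (H *\<^sub>v v)"
    using N by (simp add: H(2))
  also have "\<dots> = 1"
    using unitary_scalar_prod[OF HU v v] norm by simp
  finally have c: "c * cnj c = 1" .
  then have cmod: "cmod c = 1"
    by (metis complex_norm_square norm_ge_zero of_real_eq_1_iff power2_eq_1_iff
        abs_of_nonneg abs_minus_cancel abs_one)
  \<comment> \<open>Entry 1 compensates the phase in entry 0, which is where dimension at least 2
    enters.\<close>
  define f where "f = (\<lambda>i::nat. if i = 0 then c else if i = 1 then cnj c else 1)"
  have "(\<Prod>i<N. f i) = (\<Prod>i\<in>{0,1}. f i)"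
    using N by (intro prod.mono_neutral_right) (auto simp: f_def)
  then have D: "mat_diag N f \<in> SU N"
    using c cmod mat_diag_unitary[of N f] by (simp add: SU_eq det_mat_diag f_def)
  have "mat_adjoint H * mat_diag N f *\<^sub>v unit_vec N 0
      = mat_adjoint H *\<^sub>v (mat_diag N f *\<^sub>v unit_vec N 0)"
    using unitary_mats_carrier[OF HU] by (simp add: assoc_mult_mat_vec[of _ N N _ N])
  also have "mat_diag N f *\<^sub>v unit_vec N 0 = H *\<^sub>v v"
    using N by (simp add: mat_diag_mult_unit_vec H(2) f_def)
  also have "mat_adjoint H *\<^sub>v (H *\<^sub>v v) = v"
    by (rule unitary_adjoint_mult_vec) fact+
  finally show thesis
    using that SU_mult[OF SU_adjoint[OF H(1)] D] by blast
qed

section \<open>Polynomial identities on the unit circle\<close>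

text \<open>A circle with only \<open>k\<close> points would still have to contain all
  \<open>k + 1\<close> roots of unity of order \<open>k + 1\<close>.\<close>

lemma infinite_unit_circle: "infinite {z. cmod z = 1}"
proof
  assume fin: "finite {z. cmod z = 1}"
  let ?n = "Suc (card {z. cmod z = 1})"
  have "card {z::complex. z ^ ?n = 1} = ?n"
    by (rule card_roots_unity_eq) simp
  moreover have "{z::complex. z ^ ?n = 1} \<subseteq> {z. cmod z = 1}"
  proof safe
    fix z :: complex assume "z ^ ?n = 1"
    then show "cmod z = 1"
      using power_eq_1_iff[of z ?n] by simp
  qed
  ultimately have "?n \<le> card {z. cmod z = 1}"
    using card_mono[OF fin] by metis
  then show False by simp
qed

lemma poly_eq_on_unit_circle:
  fixes p q :: "complex poly"
  assumes "\<And>z. cmod z = 1 \<Longrightarrow> poly p z = poly q z"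
  shows "p = q"
proof (rule ccontr)
  assume "p \<noteq> q"
  then have "finite {z. poly (p - q) z = 0}"
    by (intro poly_roots_finite) simp
  moreover have "{z. cmod z = 1} \<subseteq> {z. poly (p - q) z = 0}"
    using assms by auto
  ultimately show False
    using infinite_unit_circle finite_subset by blast
qed

text \<open>On the circle the conjugate of \<open>z\<close> is its inverse, so multiplying the
  normalisation by the \<open>m\<close>-th power of \<open>z\<close> clears all negative powers. The
  result is a polynomial identity whose constant coefficient is the claim.\<close>

lemma extreme_coeffs_orthogonal:
  fixes P :: "nat \<Rightarrow> complex poly"
  assumes deg: "\<And>x. x < N \<Longrightarrow> degree (P x) \<le> m" and m: "m > 0"
    and norm: "\<And>z. cmod z = 1 \<Longrightarrow> (\<Sum>x<N. (cmod (poly (P x) z))\<^sup>2) = 1"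
  shows "(\<Sum>x<N. coeff (P x) 0 * cnj (coeff (P x) m)) = 0"
proof -
  \<comment> \<open>On the unit circle \<open>R x\<close> takes the value \<open>z\<^sup>m\<close> times the conjugate of \<open>P x\<close>.\<close>
  define R where "R x = (\<Sum>k\<le>m. monom (cnj (coeff (P x) k)) (m - k))" for x
  have R: "poly (R x) z = z ^ m * cnj (poly (P x) z)" if "x < N" "cmod z = 1" for x z
  proof -
    have zz: "z * cnj z = 1"
      using that by (simp flip: complex_norm_square)
    have pow: "z ^ m * cnj z ^ k = z ^ (m - k)" if "k \<le> m" for k
    proof -
      have "z ^ m * cnj z ^ k = z ^ (m - k) * (z * cnj z) ^ k"
        using that by (simp add: power_mult_distrib flip: power_add mult.assoc)
      then show ?thesis by (simp add: zz)
    qed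
    have "poly (P x) z = (\<Sum>k\<le>m. coeff (P x) k * z ^ k)"
      unfolding poly_altdef using deg[OF that(1)]
      by (intro sum.mono_neutral_left) (auto simp: coeff_eq_0)
    then have "z ^ m * cnj (poly (P x) z) = (\<Sum>k\<le>m. cnj (coeff (P x) k) * (z ^ m * cnj z ^ k))"
      by (simp add: sum_distrib_left mult.left_commute)
    also have "\<dots> = (\<Sum>k\<le>m. cnj (coeff (P x) k) * z ^ (m - k))"
      by (intro sum.cong) (auto simp: pow)
    finally show ?thesis
      by (simp add: R_def poly_sum poly_monom)
  qed
  have "(\<Sum>x<N. P x * R x) = monom 1 m"
  proof (rule poly_eq_on_unit_circle)
    fix z :: complex assume z: "cmod z = 1"
    have "poly (\<Sum>x<N. P x * R x) z = (\<Sum>x<N. z ^ m * complex_of_real ((cmod (poly (P x) z))\<^sup>2))"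
      using R[OF _ z] by (simp only: poly_sum poly_mult complex_norm_square)
        (auto intro!: sum.cong simp: mult_ac)
    also have "\<dots> = z ^ m * complex_of_real (\<Sum>x<N. (cmod (poly (P x) z))\<^sup>2)"
      by (simp add: sum_distrib_left)
    finally show "poly (\<Sum>x<N. P x * R x) z = poly (monom 1 m) z"
      using norm[OF z] by (simp add: poly_monom)
  qed
  \<comment> \<open>Evaluation at 0 extracts the constant coefficient; it vanishes on the right
    because \<open>m > 0\<close>.\<close>
  then have "poly (\<Sum>x<N. P x * R x) 0 = 0"
    using m by (simp add: poly_monom)
  moreover have "poly (R x) 0 = cnj (coeff (P x) m)" for x
  proof -
    have "poly (R x) 0 = (\<Sum>k\<le>m. cnj (coeff (P x) k) * 0 ^ (m - k))"
      by (simp add: R_def poly_sum poly_monom)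
    also have "\<dots> = (\<Sum>k\<le>m. if k = m then cnj (coeff (P x) k) else 0)"
      by (intro sum.cong) auto
    finally have "poly (R x) 0 = (\<Sum>k\<le>m. if k = m then cnj (coeff (P x) k) else 0)" .
    then show ?thesis by simp
  qed
  ultimately show ?thesis
    by (simp add: poly_0_coeff_0 coeff_sum coeff_mult_0)
qed

section \<open>Products of constant matrices interleaved with \<open>w_tilde\<close>\<close>

lemma w_tilde_carrier [simp]: "w_tilde b z \<in> carrier_mat (2 ^ b) (2 ^ b)"
  by (simp add: w_tilde_def)

lemma w_tilde_unitary: "cmod z = 1 \<Longrightarrow> w_tilde b z \<in> unitary_mats (2 ^ b)"
  unfolding w_tilde_def by (rule mat_diag_unitary) auto

lemma qsp_product_carrier:
  assumes "\<And>k. k \<le> n \<Longrightarrow> A k \<in> carrier_mat (2 ^ b) (2 ^ b)"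
  shows "qsp_product b A z n \<in> carrier_mat (2 ^ b) (2 ^ b)"
  using assms by (induction n) (auto intro!: mult_carrier_mat)

lemma qsp_product_unitary:
  assumes "\<And>k. k \<le> n \<Longrightarrow> A k \<in> unitary_mats (2 ^ b)" "cmod z = 1"
  shows "qsp_product b A z n \<in> unitary_mats (2 ^ b)"
  using assms by (induction n) (auto intro!: unitary_mats_mult w_tilde_unitary)

lemma qsp_product_cong:
  assumes "\<And>k. k \<le> n \<Longrightarrow> A k = B k"
  shows "qsp_product b A z n = qsp_product b B z n"
  using assms by (induction n) auto

lemma qsp_product_Suc_mult_vec:
  assumes "\<And>k. k \<le> Suc n \<Longrightarrow> A k \<in> carrier_mat (2 ^ b) (2 ^ b)" "v \<in> carrier_vec (2 ^ b)"
  shows "qsp_product b A z (Suc n) *\<^sub>v v = A (Suc n) *\<^sub>v (w_tilde b z *\<^sub>v (qsp_product b A z n *\<^sub>v v))"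
proof -
  have A: "A (Suc n) \<in> carrier_mat (2 ^ b) (2 ^ b)"
    and Q: "qsp_product b A z n \<in> carrier_mat (2 ^ b) (2 ^ b)"
    using assms(1) by (auto intro!: qsp_product_carrier)
  have "qsp_product b A z (Suc n) *\<^sub>v v = A (Suc n) * w_tilde b z *\<^sub>v (qsp_product b A z n *\<^sub>v v)"
    unfolding qsp_product.simps
    by (rule assoc_mult_mat_vec[OF mult_carrier_mat[OF A w_tilde_carrier] Q assms(2)])
  also have "\<dots> = A (Suc n) *\<^sub>v (w_tilde b z *\<^sub>v (qsp_product b A z n *\<^sub>v v))"
    by (rule assoc_mult_mat_vec[OF A w_tilde_carrier mult_mat_vec_carrier[OF Q assms(2)]])
  finally show ?thesis .
qed

lemma poly_mult_vec:
  assumes "A \<in> carrier_mat N N"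
  shows "A *\<^sub>v vec N (\<lambda>x. poly (P x) z)
    = vec N (\<lambda>x. poly (\<Sum>y<N. smult (A $$ (x, y)) (P y)) z)"
  using assms by (intro eq_vecI) (auto simp: scalar_prod_def poly_sum lessThan_atLeast0)

text \<open>Constant matrices only form linear combinations of the entries, and each
  \<open>w_tilde\<close> multiplies some entries by \<open>z\<close>, so the degree grows by at most
  one per factor.\<close>

lemma qsp_product_polynomial:
  assumes "\<And>k. k \<le> n \<Longrightarrow> A k \<in> carrier_mat (2 ^ b) (2 ^ b)"
  shows "\<exists>Q. (\<forall>x<2 ^ b. degree (Q x) \<le> n) \<and>
    (\<forall>z. qsp_product b A z n *\<^sub>v unit_vec (2 ^ b) 0 = vec (2 ^ b) (\<lambda>x. poly (Q x) z))"
  using assms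
proof (induction n)
  case 0
  let ?Q = "\<lambda>x. [:(A 0 *\<^sub>v unit_vec (2 ^ b) 0) $ x:]"
  have "A 0 *\<^sub>v unit_vec (2 ^ b) 0 = vec (2 ^ b) (\<lambda>x. poly (?Q x) z)" for z
    using 0 by (intro eq_vecI) auto
  then show ?case
    by (intro exI[of _ ?Q]) simp
next
  case (Suc n)
  then obtain Q where Q: "\<And>x. x < 2 ^ b \<Longrightarrow> degree (Q x) \<le> n"
    "\<And>z. qsp_product b A z n *\<^sub>v unit_vec (2 ^ b) 0 = vec (2 ^ b) (\<lambda>x. poly (Q x) z)"
    by (metis le_SucI)
  \<comment> \<open>These are the entries after one \<open>w_tilde\<close>: \<open>pCons 0\<close>
    is multiplication by \<open>z\<close>.\<close>
  define R where "R x = (if x < 2 ^ (b - 1) then Q x else pCons 0 (Q x))" for x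
  define S where "S x = (\<Sum>y<2 ^ b. smult (A (Suc n) $$ (x, y)) (R y))" for x
  have "degree (R x) \<le> Suc n" if "x < 2 ^ b" for x
    using Q(1)[OF that] by (auto simp: R_def intro: order.trans[OF degree_pCons_le])
  then have "degree (S x) \<le> Suc n" for x
    unfolding S_def by (intro degree_sum_le) (auto intro: order.trans[OF degree_smult_le])
  moreover have "qsp_product b A z (Suc n) *\<^sub>v unit_vec (2 ^ b) 0 = vec (2 ^ b) (\<lambda>x. poly (S x) z)" for z
  proof -
    have "w_tilde b z *\<^sub>v vec (2 ^ b) (\<lambda>x. poly (Q x) z) = vec (2 ^ b) (\<lambda>x. poly (R x) z)"
      by (auto simp: w_tilde_def mat_diag_mult_vec R_def)
    then have "qsp_product b A z (Suc n) *\<^sub>v unit_vec (2 ^ b) 0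
        = A (Suc n) *\<^sub>v vec (2 ^ b) (\<lambda>x. poly (R x) z)"
      using Suc.prems by (subst qsp_product_Suc_mult_vec) (auto simp: Q(2))
    then show ?thesis
      using Suc.prems[of "Suc n"] by (simp add: poly_mult_vec S_def)
  qed
  ultimately show ?case by blast
qed

section \<open>Sufficiency: peeling off one factor at a time\<close>

lemma qsp_product_exists:
  fixes P :: "nat \<Rightarrow> complex poly"
  assumes b: "b > 0"
    and "\<And>x. x < 2 ^ b \<Longrightarrow> degree (P x) \<le> n"
    and "\<And>z. cmod z = 1 \<Longrightarrow> (\<Sum>x<2 ^ b. (cmod (poly (P x) z))\<^sup>2) = 1"
  shows "\<exists>A. (\<forall>k\<le>n. A k \<in> SU (2 ^ b)) \<and>
    (\<forall>z. cmod z = 1 \<longrightarrow>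
      qsp_product b A z n *\<^sub>v unit_vec (2 ^ b) 0 = vec (2 ^ b) (\<lambda>x. poly (P x) z))"
  using assms(2,3)
proof (induction n arbitrary: P)
  case 0
  have "(2::nat) ^ 1 \<le> 2 ^ b"
    using b by (intro power_increasing) auto
  then have N: "(2::nat) ^ b \<ge> 2" by simp
  let ?v = "\<lambda>z. vec (2 ^ b) (\<lambda>x. poly (P x) z)"
  \<comment> \<open>Degree 0 makes the target independent of \<open>z\<close>, so one matrix with
    this first column is enough.\<close>
  have v: "?v z = ?v 1" for z
  proof (rule eq_vecI)
    fix x assume "x < dim_vec (?v 1)"
    then have "degree (P x) = 0"
      using 0(1)[of x] by simp
    then obtain a where "P x = [:a:]"
      by (rule degree_eq_zeroE)
    then show "?v z $ x = ?v 1 $ x"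
      using \<open>x < dim_vec (?v 1)\<close> by simp
  qed simp
  have "?v 1 \<bullet>c ?v 1 = complex_of_real (\<Sum>x<2 ^ b. (cmod (poly (P x) 1))\<^sup>2)"
    by (subst scalar_prod_self_complex) simp
  also have "\<dots> = 1"
    using 0(2)[of 1] by simp
  finally have norm: "?v 1 \<bullet>c ?v 1 = 1" .
  obtain A where A: "A \<in> SU (2 ^ b)" "A *\<^sub>v unit_vec (2 ^ b) 0 = ?v 1"
    by (rule SU_first_column[OF vec_carrier norm N])
  have "qsp_product b (\<lambda>_. A) z 0 *\<^sub>v unit_vec (2 ^ b) 0 = ?v z" for z
    unfolding qsp_product.simps A(2) by (rule v[symmetric])
  then show ?case
    using A(1) by (intro exI[of _ "\<lambda>_. A"] conjI allI impI)
next
  case (Suc n)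
  let ?N = "2 ^ b :: nat"
  \<comment> \<open>\<open>M\<close> is the first index at which \<open>w_tilde\<close> carries
    \<open>z\<close>, so axis 0 belongs to the first half and axis \<open>M\<close> to the
    second.\<close>
  define M :: nat where "M = 2 ^ (b - 1)"
  have M: "0 < M" "M < ?N"
    using b by (auto simp: M_def)
  define C where "C k = vec ?N (\<lambda>x. coeff (P x) k)" for k
  have "C 0 \<bullet>c C (Suc n) = (\<Sum>x<?N. coeff (P x) 0 * cnj (coeff (P x) (Suc n)))"
    by (simp add: C_def scalar_prod_def lessThan_atLeast0)
  also have "\<dots> = 0"
    using Suc.prems by (intro extreme_coeffs_orthogonal) auto
  finally have orth: "C 0 \<bullet>c C (Suc n) = 0" .
  have C: "C k \<in> carrier_vec ?N" for k
    by (simp add: C_def)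
  obtain H c d where H: "H \<in> SU ?N" "H *\<^sub>v C 0 = c \<cdot>\<^sub>v unit_vec ?N 0"
    "H *\<^sub>v C (Suc n) = d \<cdot>\<^sub>v unit_vec ?N M"
    by (rule SU_onto_axes[OF C C orth, of 0 M]) (use M in auto)
  have HU: "H \<in> unitary_mats ?N"
    using H(1) by (simp add: SU_eq)
  have Hc: "H \<in> carrier_mat ?N ?N"
    by (rule unitary_mats_carrier) fact
  define R where "R x = (\<Sum>y<?N. smult (H $$ (x, y)) (P y))" for x
  have coeff_R: "coeff (R x) k = (H *\<^sub>v C k) $ x" if "x < ?N" for x k
    using that Hc by (simp add: R_def coeff_sum C_def scalar_prod_def lessThan_atLeast0)
  have deg_R: "degree (R x) \<le> Suc n" for x
    unfolding R_def using Suc.prems(1)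
    by (intro degree_sum_le) (auto intro: order.trans[OF degree_smult_le])
  have HP: "H *\<^sub>v vec ?N (\<lambda>x. poly (P x) z) = vec ?N (\<lambda>x. poly (R x) z)" for z
    using Hc by (simp add: poly_mult_vec R_def)
  \<comment> \<open>\<open>Q\<close> is \<open>R\<close> with \<open>w_tilde\<close> undone:
    \<open>poly_shift 1\<close> drops the constant coefficient and divides by
    \<open>z\<close>.\<close>
  define Q where "Q x = (if x < M then R x else poly_shift 1 (R x))" for x
  \<comment> \<open>The top coefficient vector was moved onto axis \<open>M\<close>, so it has no
    entries in the first half.\<close>
  have R_low: "degree (R x) \<le> n" if "x < M" for x
  proof -
    have "coeff (R x) (Suc n) = 0"
      using that M coeff_R[of x "Suc n"] by (simp add: H(3))
    then show ?thesis
      using deg_R[of x] by (metis degree_0 le_SucE le0 leading_coeff_0_iff)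
  qed
  \<comment> \<open>The constant coefficient vector was moved onto axis 0, so the second half is
    divisible by \<open>z\<close>.\<close>
  have R_high: "R x = pCons 0 (Q x)" if "M \<le> x" "x < ?N" for x
  proof -
    have "coeff (R x) 0 = 0"
      using that M coeff_R[of x 0] by (simp add: H(2))
    then show ?thesis
      using that by (intro poly_eqI)
        (auto simp: Q_def coeff_pCons coeff_poly_shift split: nat.split)
  qed
  have deg_Q: "degree (Q x) \<le> n" if "x < ?N" for x
  proof (cases "x < M")
    case True
    then show ?thesis using R_low by (simp add: Q_def)
  next
    case False
    then show ?thesis
      using R_high[of x] that deg_R[of x] by (cases "Q x = 0") auto
  qed
  have wQ: "w_tilde b z *\<^sub>v vec ?N (\<lambda>x. poly (Q x) z) = vec ?N (\<lambda>x. poly (R x) z)" for z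
  proof -
    have "poly (R x) z = (if x < M then 1 else z) * poly (Q x) z" if "x < ?N" for x
    proof (cases "x < M")
      case True
      then show ?thesis by (simp add: Q_def)
    next
      case False
      then have "R x = pCons 0 (Q x)"
        using that by (intro R_high) auto
      then show ?thesis
        using False by (simp only: poly_pCons) simp
    qed
    then have "vec ?N (\<lambda>x. (if x < M then 1 else z) * poly (Q x) z) = vec ?N (\<lambda>x. poly (R x) z)"
      by (intro eq_vecI) (simp_all only: dim_vec index_vec)
    moreover have "w_tilde b z *\<^sub>v vec ?N (\<lambda>x. poly (Q x) z)
        = vec ?N (\<lambda>x. (if x < M then 1 else z) * poly (Q x) z)"
      unfolding w_tilde_def M_def by (subst mat_diag_mult_vec) (auto intro!: eq_vecI)
    ultimately show ?thesis by (rule trans[rotated])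
  qed
  \<comment> \<open>On the circle both \<open>H\<close> and \<open>w_tilde b z\<close> preserve the
    norm, so \<open>Q\<close> inherits the normalisation of \<open>P\<close>.\<close>
  have "(\<Sum>x<?N. (cmod (poly (Q x) z))\<^sup>2) = 1" if z: "cmod z = 1" for z
  proof -
    let ?q = "vec ?N (\<lambda>x. poly (Q x) z)" and ?p = "vec ?N (\<lambda>x. poly (P x) z)"
    have "?q \<bullet>c ?q = (w_tilde b z *\<^sub>v ?q) \<bullet>c (w_tilde b z *\<^sub>v ?q)"
      using unitary_scalar_prod[OF w_tilde_unitary[OF z], of ?q b ?q] by simp
    also have "w_tilde b z *\<^sub>v ?q = H *\<^sub>v ?p"
      by (simp add: wQ HP)
    also have "(H *\<^sub>v ?p) \<bullet>c (H *\<^sub>v ?p) = ?p \<bullet>c ?p"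
      by (rule unitary_scalar_prod[OF HU]) auto
    also have "\<dots> = complex_of_real (\<Sum>x<?N. (cmod (poly (P x) z))\<^sup>2)"
      by (subst scalar_prod_self_complex) simp
    also have "\<dots> = 1"
      using Suc.prems(2)[OF z] by simp
    finally have "complex_of_real (\<Sum>x<?N. (cmod (poly (Q x) z))\<^sup>2) = 1"
      by (subst (asm) scalar_prod_self_complex) simp
    then show ?thesis
      by (simp only: of_real_eq_1_iff)
  qed
  then obtain A where A: "\<And>k. k \<le> n \<Longrightarrow> A k \<in> SU ?N"
    "\<And>z. cmod z = 1 \<Longrightarrow> qsp_product b A z n *\<^sub>v unit_vec ?N 0 = vec ?N (\<lambda>x. poly (Q x) z)"
    using Suc.IH[of Q] deg_Q by blast
  \<comment> \<open>The new outermost factor undoes \<open>H\<close>; the first \<open>n + 1\<close>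
    factors stay those found for \<open>Q\<close>.\<close>
  define B where "B = A(Suc n := mat_adjoint H)"
  have B: "B k \<in> SU ?N" if "k \<le> Suc n" for k
    using that A(1) SU_adjoint[OF H(1)] by (auto simp: B_def le_Suc_eq)
  have "qsp_product b B z (Suc n) *\<^sub>v unit_vec ?N 0 = vec ?N (\<lambda>x. poly (P x) z)"
    if z: "cmod z = 1" for z
  proof -
    have "qsp_product b B z n = qsp_product b A z n"
      by (rule qsp_product_cong) (simp add: B_def)
    then have "qsp_product b B z (Suc n) *\<^sub>v unit_vec ?N 0
        = mat_adjoint H *\<^sub>v (w_tilde b z *\<^sub>v vec ?N (\<lambda>x. poly (Q x) z))"
      using B A(2)[OF z] by (subst qsp_product_Suc_mult_vec) (auto simp: SU_def B_def)
    also have "\<dots> = mat_adjoint H *\<^sub>v (H *\<^sub>v vec ?N (\<lambda>x. poly (P x) z))"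
      by (simp add: wQ HP)
    also have "\<dots> = vec ?N (\<lambda>x. poly (P x) z)"
      by (rule unitary_adjoint_mult_vec[OF HU]) simp
    finally show ?thesis .
  qed
  then show ?case
    using B by (intro exI[of _ B] conjI allI impI)
qed

section \<open>Necessity and the resulting equivalence\<close>

theorem theorem3:
  fixes b n :: nat and P :: "nat \<Rightarrow> complex poly"
  assumes "b > 1"
  shows "(\<exists>A. (\<forall>k\<le>n. A k \<in> SU (2 ^ b)) \<and>
            (\<forall>z. cmod z = 1 \<longrightarrow>
               qsp_product b A z n *\<^sub>v unit_vec (2 ^ b) 0 = vec (2 ^ b) (\<lambda>x. poly (P x) z)))
         \<longleftrightarrow>
         (\<forall>x < 2 ^ b. degree (P x) \<le> n) \<and>
         (\<forall>z. cmod z = 1 \<longrightarrow> (\<Sum>x < 2 ^ b. (cmod (poly (P x) z))\<^sup>2) = 1)"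
    (is "?L \<longleftrightarrow> ?R")
proof
  assume ?L
  then obtain A where A: "\<And>k. k \<le> n \<Longrightarrow> A k \<in> SU (2 ^ b)"
    and prod: "\<And>z. cmod z = 1 \<Longrightarrow>
      qsp_product b A z n *\<^sub>v unit_vec (2 ^ b) 0 = vec (2 ^ b) (\<lambda>x. poly (P x) z)"
    by blast
  obtain Q where Q: "\<And>x. x < 2 ^ b \<Longrightarrow> degree (Q x) \<le> n"
    "\<And>z. qsp_product b A z n *\<^sub>v unit_vec (2 ^ b) 0 = vec (2 ^ b) (\<lambda>x. poly (Q x) z)"
    using qsp_product_polynomial[of n A b] A by (auto simp: SU_def)
  \<comment> \<open>The product determines \<open>P\<close> only on the circle, but agreement there
    forces equality of polynomials, which transfers the degree bound from \<open>Q\<close> to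
    \<open>P\<close>.\<close>
  have "P x = Q x" if "x < 2 ^ b" for x
  proof (rule poly_eq_on_unit_circle)
    fix z :: complex assume "cmod z = 1"
    then have "vec (2 ^ b) (\<lambda>x. poly (P x) z) $ x = vec (2 ^ b) (\<lambda>x. poly (Q x) z) $ x"
      using prod Q(2) by simp
    then show "poly (P x) z = poly (Q x) z"
      using that by simp
  qed
  \<comment> \<open>The values of \<open>P\<close> form the first column of a unitary
    matrix.\<close>
  moreover have "(\<Sum>x<2 ^ b. (cmod (poly (P x) z))\<^sup>2) = 1" if z: "cmod z = 1" for z
  proof -
    let ?U = "qsp_product b A z n" and ?e = "unit_vec (2 ^ b) 0 :: complex vec"
    have "?U \<in> unitary_mats (2 ^ b)"
      using A z by (intro qsp_product_unitary) (auto simp: SU_eq)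
    then have "(?U *\<^sub>v ?e) \<bullet>c (?U *\<^sub>v ?e) = ?e \<bullet>c ?e"
      by (rule unitary_scalar_prod) auto
    also have "\<dots> = 1"
      by simp
    finally have "complex_of_real (\<Sum>x<2 ^ b. (cmod (poly (P x) z))\<^sup>2) = 1"
      unfolding prod[OF z] by (subst (asm) scalar_prod_self_complex) simp
    then show ?thesis
      by (simp only: of_real_eq_1_iff)
  qed
  ultimately show ?R
    using Q(1) by auto
next
  assume ?R
  then show ?L
    using assms by (intro qsp_product_exists) auto
qed

end
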